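(* Let $(\boldsymbol{X},\boldsymbol{T})$ and $(\boldsymbol{Y},\boldsymbol{R})$ be nonautonomous dynamical systems, $Z\subset X_0$ and $W\subset Y_0$. Then for all equicontinuous $\boldsymbol{f}\in\boldsymbol{C}(\boldsymbol{X},\mathbb{R})$ and equicontinuous $\boldsymbol{g}\in\boldsymbol{C}(\boldsymbol{Y},\mathbb{R})$, $$P^{\mathrm{L}}(\boldsymbol{T},\boldsymbol{f},Z)+P^{\mathrm{U}}(\boldsymbol{R},\boldsymbol{g},W)\le P^{\mathrm{U}}(\boldsymbol{T}\times\boldsymbol{R},\boldsymbol{f}\dotplus\boldsymbol{g},Z\times W)\le P^{\mathrm{U}}(\boldsymbol{T},\boldsymbol{f},Z)+P^{\mathrm{U}}(\boldsymbol{R},\boldsymbol{g},W),$$ where it is assumed that the sums of pressures appearing are well defined, i.e. not of the form $\infty-\infty$.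
   Context: A nonautonomous dynamical system (NDS) $(\boldsymbol{X},\boldsymbol{T})$ consists of a sequence $\boldsymbol{X}=\{X_k\}_{k=0}^\infty$ of compact metric spaces $(X_k,d_k)$ and a sequence $\boldsymbol{T}=\{T_k\}_{k=0}^\infty$ of continuous maps $T_k:X_k\to X_{k+1}$. Write $\boldsymbol{T}^0=\mathrm{id}_{X_0}$ and $\boldsymbol{T}^j=T_{j-1}\circ\cdots\circ T_0:X_0\to X_j$. For $n\ge 1$ the $n$-th Bowen metric on $X_0$ is $d_n^{\boldsymbol{T}}(x,y)=\max_{0\le j\le n-1}d_j(\boldsymbol{T}^jx,\boldsymbol{T}^jy)$. $\boldsymbol{C}(\boldsymbol{X},\mathbb{R})=\prod_{k\ge 0}C(X_k,\mathbb{R})$ is the set of sequences $\boldsymbol{f}=\{f_k\}_{k=0}^\infty$ of continuous functions $f_k:X_k\to\mathbb{R}$, and $S_n^{\boldsymbol{T}}\boldsymbol{f}=\sum_{j=0}^{n-1}f_j\circ\boldsymbol{T}^j$. $\boldsymbol{f}$ is equicontinuous if for every $\varepsilon>0$ there is $\delta>0$ such that for all $k\ge0$ and $x,y\in X_k$ with $d_k(x,y)<\delta$ we have $|f_k(x)-f_k(y)|<\varepsilon$. Products. $\boldsymbol{X}\times\boldsymbol{Y}=\{X_k\times Y_k\}_{k\ge0}$ with metrics $\max\{d_{X_k}(x_1,x_2),d_{Y_k}(y_1,y_2)\}$; $\boldsymbol{T}\times\boldsymbol{R}=\{T_k\times R_k\}_{k\ge0}$ with $(T_k\times R_k)(x,y)=(T_kx,R_ky)$;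 $\boldsymbol{f}\dotplus\boldsymbol{g}=\{f_k\dotplus g_k\}_{k\ge0}$ with $(f_k\dotplus g_k)(x,y)=f_k(x)+g_k(y)$. Lower and upper pressures. For $Z\subset X_0$, $n\ge1$, $\varepsilon>0$: $F\subset X_0$ is $(n,\varepsilon)$-spanning for $Z$ if for every $x\in Z$ there is $y\in F$ with $d_n^{\boldsymbol{T}}(x,y)\le\varepsilon$; $E\subset Z$ is $(n,\varepsilon)$-separated for $Z$ if $d_n^{\boldsymbol{T}}(x,y)>\varepsilon$ for all distinct $x,y\in E$. Let $Q_n(\boldsymbol{T},\boldsymbol{f},Z,\varepsilon)=\inf_F\sum_{x\in F}e^{S_n^{\boldsymbol{T}}\boldsymbol{f}(x)}$ over $(n,\varepsilon)$-spanning sets $F$ for $Z$ and $P_n(\boldsymbol{T},\boldsymbol{f},Z,\varepsilon)=\sup_E\sum_{x\in E}e^{S_n^{\boldsymbol{T}}\boldsymbol{f}(x)}$ over $(n,\varepsilon)$-separated sets $E$ for $Z$. Let $\underline{Q}(\boldsymbol{T},\boldsymbol{f},Z,\varepsilon)$, $\overline{Q}(\boldsymbol{T},\boldsymbol{f},Z,\varepsilon)$ be the $\liminf$, $\limsup$ as $n\to\infty$ of $\frac1n\log Q_n(\boldsymbol{T},\boldsymbol{f},Z,\varepsilon)$, and $\underline{P}(\boldsymbol{T},\boldsymbol{f},Z,\varepsilon)$, $\overline{P}(\boldsymbol{T},\boldsymbol{f},Z,\varepsilon)$ those of $\frac1n\log P_n(\boldsymbol{T},\boldsymbol{f},Z,\varepsilon)$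 ($\log 0=-\infty$). Then $\underline{Q},\overline{Q},\underline{P},\overline{P}(\boldsymbol{T},\boldsymbol{f},Z)\in\mathbb{R}\cup\{\pm\infty\}$ are the (monotone) limits of these as $\varepsilon\to0$. When $\underline{Q}(\boldsymbol{T},\boldsymbol{f},Z)=\underline{P}(\boldsymbol{T},\boldsymbol{f},Z)$ the common value is denoted $P^{\mathrm{L}}(\boldsymbol{T},\boldsymbol{f},Z)$; when $\overline{Q}(\boldsymbol{T},\boldsymbol{f},Z)=\overline{P}(\boldsymbol{T},\boldsymbol{f},Z)$ the common value is denoted $P^{\mathrm{U}}(\boldsymbol{T},\boldsymbol{f},Z)$. Both equalities hold whenever $\boldsymbol{f}$ is equicontinuous. *)

theory Defs
  imports "HOL-Analysis.Analysis"
begin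

section \<open>Nonautonomous dynamical systems\<close>

text \<open>
  The spaces \<open>X k\<close> may be unrelated to each other; they are values of type \<open>'a metric\<close>, i.e. they
  live on arbitrary carrier sets inside one common type. This is no restriction, since any sequence
  of metric spaces embeds isometrically into such a type via the disjoint union. Maps and functions
  are total in HOL, but only their values on the carriers \<open>mspace (X k)\<close> are ever used.
\<close>

definition nds :: "(nat \<Rightarrow> 'a metric) \<Rightarrow> (nat \<Rightarrow> 'a \<Rightarrow> 'a) \<Rightarrow> bool" where
  "nds X T \<longleftrightarrow>
     (\<forall>k. compact_space (mtopology_of (X k)) \<and>
          continuous_map (mtopology_of (X k)) (mtopology_of (X (Suc k))) (T k))"

primrec orbit_map :: "(nat \<Rightarrow> 'a \<Rightarrow> 'a) \<Rightarrow> nat \<Rightarrow> 'a \<Rightarrow> 'a" where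
  "orbit_map T 0 = id"
| "orbit_map T (Suc j) = T j \<circ> orbit_map T j"

text \<open>Only meaningful for \<open>n \<ge> 1\<close>; the value at \<open>n = 0\<close> is irrelevant for the limits below.\<close>

definition bowen_dist ::
  "(nat \<Rightarrow> 'a metric) \<Rightarrow> (nat \<Rightarrow> 'a \<Rightarrow> 'a) \<Rightarrow> nat \<Rightarrow> 'a \<Rightarrow> 'a \<Rightarrow> real" where
  "bowen_dist X T n x y =
     Max ((\<lambda>j. mdist (X j) (orbit_map T j x) (orbit_map T j y)) ` {0..<n})"

definition continuous_seqs :: "(nat \<Rightarrow> 'a metric) \<Rightarrow> (nat \<Rightarrow> 'a \<Rightarrow> real) set" where
  "continuous_seqs X = {f. \<forall>k. continuous_map (mtopology_of (X k)) euclideanreal (f k)}"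

definition birkhoff_sum ::
  "(nat \<Rightarrow> 'a \<Rightarrow> 'a) \<Rightarrow> (nat \<Rightarrow> 'a \<Rightarrow> real) \<Rightarrow> nat \<Rightarrow> 'a \<Rightarrow> real" where
  "birkhoff_sum T f n x = (\<Sum>j<n. f j (orbit_map T j x))"

definition equicontinuous :: "(nat \<Rightarrow> 'a metric) \<Rightarrow> (nat \<Rightarrow> 'a \<Rightarrow> real) \<Rightarrow> bool" where
  "equicontinuous X f \<longleftrightarrow>
     (\<forall>\<epsilon>>0. \<exists>\<delta>>0. \<forall>k. \<forall>x\<in>mspace (X k). \<forall>y\<in>mspace (X k).
        mdist (X k) x y < \<delta> \<longrightarrow> \<bar>f k x - f k y\<bar> < \<epsilon>)"


section \<open>Products\<close>

text \<open>The library's \<^const>\<open>prod_metric\<close> is the Euclidean product; here the maximum metric is used.\<close>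

definition max_metric :: "'a metric \<Rightarrow> 'b metric \<Rightarrow> ('a \<times> 'b) metric" where
  "max_metric A B =
     metric (mspace A \<times> mspace B,
             \<lambda>p q. max (mdist A (fst p) (fst q)) (mdist B (snd p) (snd q)))"

lemma Metric_space_max_metric:
  "Metric_space (mspace A \<times> mspace B)
     (\<lambda>p q. max (mdist A (fst p) (fst q)) (mdist B (snd p) (snd q)))"
proof
  fix p q r
  show "0 \<le> max (mdist A (fst p) (fst q)) (mdist B (snd p) (snd q))"
    by (simp add: le_max_iff_disj)
  show "max (mdist A (fst p) (fst q)) (mdist B (snd p) (snd q)) =
        max (mdist A (fst q) (fst p)) (mdist B (snd q) (snd p))"
    by (simp add: mdist_commute)
  assume p: "p \<in> mspace A \<times> mspace B" and q: "q \<in> mspace A \<times> mspace B"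
  have "max a b = 0 \<longleftrightarrow> a = 0 \<and> b = 0" if "0 \<le> a" "0 \<le> b" for a b :: real
    using that by (auto simp: max_def)
  then show "max (mdist A (fst p) (fst q)) (mdist B (snd p) (snd q)) = 0 \<longleftrightarrow> p = q"
    using p q by (auto simp: mem_Times_iff prod_eq_iff)
  assume r: "r \<in> mspace A \<times> mspace B"
  have "mdist A (fst p) (fst r) \<le> mdist A (fst p) (fst q) + mdist A (fst q) (fst r)"
       "mdist B (snd p) (snd r) \<le> mdist B (snd p) (snd q) + mdist B (snd q) (snd r)"
    using p q r by (auto simp: mem_Times_iff intro: mdist_triangle)
  then show "max (mdist A (fst p) (fst r)) (mdist B (snd p) (snd r)) \<le>
      max (mdist A (fst p) (fst q)) (mdist B (snd p) (snd q)) +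
      max (mdist A (fst q) (fst r)) (mdist B (snd q) (snd r))"
    by linarith
qed

lemma mspace_max_metric [simp]: "mspace (max_metric A B) = mspace A \<times> mspace B"
  unfolding max_metric_def by (rule Metric_space.mspace_metric[OF Metric_space_max_metric])

lemma mdist_max_metric:
  "mdist (max_metric A B) p q = max (mdist A (fst p) (fst q)) (mdist B (snd p) (snd q))"
  unfolding max_metric_def by (simp add: Metric_space.mdist_metric[OF Metric_space_max_metric])

definition prod_spaces ::
  "(nat \<Rightarrow> 'a metric) \<Rightarrow> (nat \<Rightarrow> 'b metric) \<Rightarrow> nat \<Rightarrow> ('a \<times> 'b) metric" where
  "prod_spaces X Y k = max_metric (X k) (Y k)"

definition prod_maps ::
  "(nat \<Rightarrow> 'a \<Rightarrow> 'a) \<Rightarrow> (nat \<Rightarrow> 'b \<Rightarrow> 'b) \<Rightarrow> nat \<Rightarrow> 'a \<times> 'b \<Rightarrow> 'a \<times> 'b" where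
  "prod_maps T R k = map_prod (T k) (R k)"

definition dotplus ::
  "(nat \<Rightarrow> 'a \<Rightarrow> real) \<Rightarrow> (nat \<Rightarrow> 'b \<Rightarrow> real) \<Rightarrow> nat \<Rightarrow> 'a \<times> 'b \<Rightarrow> real" where
  "dotplus f g k = (\<lambda>(x, y). f k x + g k y)"


section \<open>Lower and upper pressures\<close>

definition spanning ::
  "(nat \<Rightarrow> 'a metric) \<Rightarrow> (nat \<Rightarrow> 'a \<Rightarrow> 'a) \<Rightarrow> 'a set \<Rightarrow> nat \<Rightarrow> real \<Rightarrow> 'a set \<Rightarrow> bool" where
  "spanning X T Z n \<epsilon> F \<longleftrightarrow>
     F \<subseteq> mspace (X 0) \<and> (\<forall>x\<in>Z. \<exists>y\<in>F. bowen_dist X T n x y \<le> \<epsilon>)"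

definition separated ::
  "(nat \<Rightarrow> 'a metric) \<Rightarrow> (nat \<Rightarrow> 'a \<Rightarrow> 'a) \<Rightarrow> 'a set \<Rightarrow> nat \<Rightarrow> real \<Rightarrow> 'a set \<Rightarrow> bool" where
  "separated X T Z n \<epsilon> E \<longleftrightarrow>
     E \<subseteq> Z \<and> (\<forall>x\<in>E. \<forall>y\<in>E. x \<noteq> y \<longrightarrow> bowen_dist X T n x y > \<epsilon>)"

text \<open>
  Spanning sets may be infinite. The unordered sum \<^const>\<open>infsum\<close> of nonnegative extended reals
  is used because \<^const>\<open>sum\<close> vanishes on infinite sets.
\<close>

definition exp_sum ::
  "(nat \<Rightarrow> 'a \<Rightarrow> 'a) \<Rightarrow> (nat \<Rightarrow> 'a \<Rightarrow> real) \<Rightarrow> nat \<Rightarrow> 'a set \<Rightarrow> ereal" where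
  "exp_sum T f n A = (\<Sum>\<^sub>\<infinity>x\<in>A. ereal (exp (birkhoff_sum T f n x)))"

definition Q_n ::
  "(nat \<Rightarrow> 'a metric) \<Rightarrow> (nat \<Rightarrow> 'a \<Rightarrow> 'a) \<Rightarrow> (nat \<Rightarrow> 'a \<Rightarrow> real) \<Rightarrow> 'a set \<Rightarrow> real \<Rightarrow> nat \<Rightarrow> ereal"
  where "Q_n X T f Z \<epsilon> n = (INF F\<in>{F. spanning X T Z n \<epsilon> F}. exp_sum T f n F)"

definition P_n ::
  "(nat \<Rightarrow> 'a metric) \<Rightarrow> (nat \<Rightarrow> 'a \<Rightarrow> 'a) \<Rightarrow> (nat \<Rightarrow> 'a \<Rightarrow> real) \<Rightarrow> 'a set \<Rightarrow> real \<Rightarrow> nat \<Rightarrow> ereal"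
  where "P_n X T f Z \<epsilon> n = (SUP E\<in>{E. separated X T Z n \<epsilon> E}. exp_sum T f n E)"

definition log_ereal :: "ereal \<Rightarrow> ereal" where
  "log_ereal x = (if x \<le> 0 then -\<infinity> else if x = \<infinity> then \<infinity> else ereal (ln (real_of_ereal x)))"

definition growth_rate :: "(nat \<Rightarrow> ereal) \<Rightarrow> nat \<Rightarrow> ereal" where
  "growth_rate a n = ereal (1 / real n) * log_ereal (a n)"

definition lower_Q ::
  "(nat \<Rightarrow> 'a metric) \<Rightarrow> (nat \<Rightarrow> 'a \<Rightarrow> 'a) \<Rightarrow> (nat \<Rightarrow> 'a \<Rightarrow> real) \<Rightarrow> 'a set \<Rightarrow> ereal" where
  "lower_Q X T f Z = Lim (at_right 0) (\<lambda>\<epsilon>::real. liminf (growth_rate (Q_n X T f Z \<epsilon>)))"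

definition upper_Q ::
  "(nat \<Rightarrow> 'a metric) \<Rightarrow> (nat \<Rightarrow> 'a \<Rightarrow> 'a) \<Rightarrow> (nat \<Rightarrow> 'a \<Rightarrow> real) \<Rightarrow> 'a set \<Rightarrow> ereal" where
  "upper_Q X T f Z = Lim (at_right 0) (\<lambda>\<epsilon>::real. limsup (growth_rate (Q_n X T f Z \<epsilon>)))"

definition lower_P ::
  "(nat \<Rightarrow> 'a metric) \<Rightarrow> (nat \<Rightarrow> 'a \<Rightarrow> 'a) \<Rightarrow> (nat \<Rightarrow> 'a \<Rightarrow> real) \<Rightarrow> 'a set \<Rightarrow> ereal" where
  "lower_P X T f Z = Lim (at_right 0) (\<lambda>\<epsilon>::real. liminf (growth_rate (P_n X T f Z \<epsilon>)))"

definition upper_P ::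
  "(nat \<Rightarrow> 'a metric) \<Rightarrow> (nat \<Rightarrow> 'a \<Rightarrow> 'a) \<Rightarrow> (nat \<Rightarrow> 'a \<Rightarrow> real) \<Rightarrow> 'a set \<Rightarrow> ereal" where
  "upper_P X T f Z = Lim (at_right 0) (\<lambda>\<epsilon>::real. limsup (growth_rate (P_n X T f Z \<epsilon>)))"

text \<open>
  The lower and upper pressures are the common values of the spanning and the separated versions,
  and are unspecified where these two versions differ.
\<close>

definition pressure_L ::
  "(nat \<Rightarrow> 'a metric) \<Rightarrow> (nat \<Rightarrow> 'a \<Rightarrow> 'a) \<Rightarrow> (nat \<Rightarrow> 'a \<Rightarrow> real) \<Rightarrow> 'a set \<Rightarrow> ereal" where
  "pressure_L X T f Z = (THE p. p = lower_Q X T f Z \<and> p = lower_P X T f Z)"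

definition pressure_U ::
  "(nat \<Rightarrow> 'a metric) \<Rightarrow> (nat \<Rightarrow> 'a \<Rightarrow> 'a) \<Rightarrow> (nat \<Rightarrow> 'a \<Rightarrow> real) \<Rightarrow> 'a set \<Rightarrow> ereal" where
  "pressure_U X T f Z = (THE p. p = upper_Q X T f Z \<and> p = upper_P X T f Z)"

text \<open>The library totalises addition by \<open>\<infinity> + (-\<infinity>) = \<infinity>\<close>; this predicate excludes that case.\<close>

definition sum_well_defined :: "ereal \<Rightarrow> ereal \<Rightarrow> bool" where
  "sum_well_defined a b \<longleftrightarrow> \<not> (a = \<infinity> \<and> b = -\<infinity>) \<and> \<not> (a = -\<infinity> \<and> b = \<infinity>)"

end

theory Submission
  imports Defs
begin

text \<open>
  Products of separated (spanning) sets are separated (spanning) for the product system, and the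
  exponential sum over a product set is the product of the exponential sums. So \<^const>\<open>P_n\<close> is
  supermultiplicative and \<^const>\<open>Q_n\<close> submultiplicative. The lower bound then follows from
  \<open>liminf + limsup \<le> limsup\<close> applied to \<^const>\<open>P_n\<close>, the upper bound from subadditivity of
  \<open>limsup\<close> applied to \<^const>\<open>Q_n\<close>; equicontinuity makes both versions of the pressure agree.
\<close>

section \<open>Extended reals\<close>

text \<open>Write \<open>v\<close> as \<open>(u + v) - u\<close> and use subadditivity of
  \<open>limsup\<close> together with \<open>limsup (- u) = - liminf u\<close>. The assumptions
  exclude opposite infinities on the left, where totalised addition would give \<infinity>.\<close>

lemma ereal_liminf_add_limsup_le:
  fixes u v :: "nat \<Rightarrow> ereal"
  assumes "\<not> (liminf u = - \<infinity> \<and> limsup v = \<infinity>)" "\<not> (liminf u = \<infinity> \<and> limsup v = - \<infinity>)"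
  shows "liminf u + limsup v \<le> limsup (\<lambda>n. u n + v n)"
proof -
  \<comment> \<open>For infinite \<open>u n\<close> the right-hand side is \<infinity> under the
    totalised addition, hence an inequality and not an equation.\<close>
  have "v n \<le> (u n + v n) + - u n" for n
    by (cases "u n"; cases "v n") auto
  then have "limsup v \<le> limsup (\<lambda>n. (u n + v n) + - u n)"
    by (intro Limsup_mono) auto
  also have "\<dots> \<le> limsup (\<lambda>n. u n + v n) + limsup (\<lambda>n. - u n)"
    by (rule ereal_limsup_add_mono)
  also have "limsup (\<lambda>n. - u n) = - liminf u"
    by (simp add: ereal_Limsup_uminus)
  finally show ?thesis
    using assms
    by (cases "liminf u"; cases "limsup v"; cases "limsup (\<lambda>n. u n + v n)") auto
qed

text \<open>A bound exceeded at one radius is exceeded at every smaller one. So \<open>Lim\<close>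
  in the pressures is a genuine limit and can be handled as a supremum.\<close>

lemma antimono_tendsto_SUP_at_right:
  fixes h :: "real \<Rightarrow> ereal"
  assumes "\<And>x y. 0 < x \<Longrightarrow> x \<le> y \<Longrightarrow> h y \<le> h x"
  shows "(h \<longlongrightarrow> (SUP x\<in>{0<..}. h x)) (at_right 0)"
proof (rule order_tendstoI)
  fix a assume "a < (SUP x\<in>{0<..}. h x)"
  then obtain e where e: "e > 0" "a < h e"
    by (auto simp: less_SUP_iff)
  have "eventually (\<lambda>x. x \<in> {0<..<e}) (at_right 0)"
    using e(1) by (rule eventually_at_right_real)
  then show "eventually (\<lambda>x. a < h x) (at_right 0)"
    by eventually_elim (use e assms in \<open>force intro: less_le_trans\<close>)
next
  fix a assume a: "(SUP x\<in>{0<..}. h x) < a"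
  have "eventually (\<lambda>x. (0::real) < x) (at_right 0)"
    by (simp add: eventually_at_right_less)
  then show "eventually (\<lambda>x. h x < a) (at_right 0)"
    by eventually_elim (use a in \<open>auto intro: le_less_trans[OF SUP_upper]\<close>)
qed

lemma antimono_Lim_at_right:
  fixes h :: "real \<Rightarrow> ereal"
  assumes "\<And>x y. 0 < x \<Longrightarrow> x \<le> y \<Longrightarrow> h y \<le> h x"
  shows "Lim (at_right 0) h = (SUP x\<in>{0<..}. h x)"
  using antimono_tendsto_SUP_at_right[OF assms] by (intro tendsto_Lim) auto

section \<open>Logarithms and growth rates of extended reals\<close>

lemma log_ereal_mono: "x \<le> y \<Longrightarrow> log_ereal x \<le> log_ereal y"
  by (cases x; cases y) (auto simp: log_ereal_def)

text \<open>Equality fails for \<open>0 * \<infinity> = 0\<close>: the left side is -\<infinity>,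
  while the right side is \<open>-\<infinity> + \<infinity> = \<infinity>\<close>.\<close>

lemma log_ereal_mult_le:
  "0 \<le> x \<Longrightarrow> 0 \<le> y \<Longrightarrow> log_ereal (x * y) \<le> log_ereal x + log_ereal y"
  by (cases x; cases y)
    (auto simp: log_ereal_def ln_mult zero_less_mult_iff mult_le_0_iff zero_ereal_def[symmetric])

lemma log_ereal_mult:
  "0 < x \<Longrightarrow> 0 < y \<Longrightarrow> log_ereal (x * y) = log_ereal x + log_ereal y"
  by (cases x; cases y) (auto simp: log_ereal_def ln_mult mult_le_0_iff)

lemma log_ereal_exp_mult:
  "0 \<le> x \<Longrightarrow> log_ereal (ereal (exp c) * x) = ereal c + log_ereal x"
  by (cases x) (auto simp: log_ereal_def ln_mult mult_le_0_iff)

lemma growth_rate_mono: "a n \<le> b n \<Longrightarrow> growth_rate a n \<le> growth_rate b n"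
  unfolding growth_rate_def by (intro ereal_mult_left_mono log_ereal_mono) auto

section \<open>Exponential sums\<close>

text \<open>The terms are nonnegative, so every estimate on a possibly infinite sum reduces to its
  finite subsums.\<close>

lemma exp_sum_eq_SUP:
  "exp_sum T f n A =
     (SUP K\<in>{K. finite K \<and> K \<subseteq> A}. ereal (\<Sum>x\<in>K. exp (birkhoff_sum T f n x)))"
  unfolding exp_sum_def by (subst nonneg_infsum_complete) auto

lemma sum_le_exp_sum:
  "finite K \<Longrightarrow> K \<subseteq> A \<Longrightarrow> ereal (\<Sum>x\<in>K. exp (birkhoff_sum T f n x)) \<le> exp_sum T f n A"
  unfolding exp_sum_eq_SUP by (rule SUP_upper) auto

lemma exp_sum_least:
  assumes "\<And>K. finite K \<Longrightarrow> K \<subseteq> A \<Longrightarrow> ereal (\<Sum>x\<in>K. exp (birkhoff_sum T f n x)) \<le> u"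
  shows "exp_sum T f n A \<le> u"
  unfolding exp_sum_eq_SUP by (rule SUP_least) (use assms in auto)

lemma exp_sum_nonneg: "0 \<le> exp_sum T f n A"
  using sum_le_exp_sum[of "{}" A T f n] by (simp add: zero_ereal_def)

lemma exp_sum_pos: "A \<noteq> {} \<Longrightarrow> 0 < exp_sum T f n A"
proof -
  assume "A \<noteq> {}"
  then obtain a where "a \<in> A" by auto
  have "(0::ereal) < ereal (exp (birkhoff_sum T f n a))"
    by simp
  also have "\<dots> \<le> exp_sum T f n A"
    using sum_le_exp_sum[of "{a}" A T f n] \<open>a \<in> A\<close> by simp
  finally show ?thesis .
qed

text \<open>Reindex each finite subsum over \<open>E\<close> along the injection: a term loses at
  most the factor \<open>exp (- c)\<close>, and the image is a finite subset of
  \<open>F\<close>.\<close>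

lemma exp_sum_inj_le:
  assumes inj: "inj_on \<phi> E" and sub: "\<phi> ` E \<subseteq> F"
    and le: "\<And>x. x \<in> E \<Longrightarrow> birkhoff_sum T f n x \<le> c + birkhoff_sum T f n (\<phi> x)"
  shows "ereal (exp (- c)) * exp_sum T f n E \<le> exp_sum T f n F"
proof -
  have "ereal (exp (- c) * (\<Sum>x\<in>K. exp (birkhoff_sum T f n x))) \<le> exp_sum T f n F"
    if K: "finite K" "K \<subseteq> E" for K
  proof -
    have "exp (- c) * (\<Sum>x\<in>K. exp (birkhoff_sum T f n x)) \<le>
        (\<Sum>x\<in>K. exp (birkhoff_sum T f n (\<phi> x)))"
      unfolding sum_distrib_left
    proof (rule sum_mono)
      fix x assume "x \<in> K"
      then show "exp (- c) * exp (birkhoff_sum T f n x) \<le> exp (birkhoff_sum T f n (\<phi> x))"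
        using le[of x] K by (auto simp flip: exp_add)
    qed
    also have "\<dots> = (\<Sum>y\<in>\<phi> ` K. exp (birkhoff_sum T f n y))"
      using inj_on_subset[OF inj K(2)] by (simp add: sum.reindex)
    finally have "ereal (exp (- c) * (\<Sum>x\<in>K. exp (birkhoff_sum T f n x))) \<le>
        ereal (\<Sum>y\<in>\<phi> ` K. exp (birkhoff_sum T f n y))"
      by simp
    also have "\<dots> \<le> exp_sum T f n F"
      using K sub by (intro sum_le_exp_sum) auto
    finally show ?thesis .
  qed
  then show ?thesis
    unfolding exp_sum_eq_SUP[of T f n E]
    by (subst Sup_ereal_mult_left') (auto intro!: SUP_least)
qed

section \<open>Bowen metrics\<close>

text \<open>For \<open>n = 0\<close> the maximum runs over the empty set and is unspecified, which
  is why \<open>0 < n\<close> recurs below and limits discard the index 0.\<close>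

lemma bowen_dist_le_iff:
  "0 < n \<Longrightarrow> bowen_dist X T n x y \<le> e \<longleftrightarrow>
     (\<forall>j<n. mdist (X j) (orbit_map T j x) (orbit_map T j y) \<le> e)"
  unfolding bowen_dist_def by (subst Max_le_iff) auto

lemma bowen_dist_commute: "bowen_dist X T n x y = bowen_dist X T n y x"
  unfolding bowen_dist_def by (simp add: mdist_commute)

text \<open>Orbits must stay in the carriers, since the triangle inequality for \<open>mdist\<close>
  is available only there. This property passes to products coordinatewise.\<close>

locale invariant_maps =
  fixes X :: "nat \<Rightarrow> 'a metric" and T :: "nat \<Rightarrow> 'a \<Rightarrow> 'a"
  assumes maps: "x \<in> mspace (X k) \<Longrightarrow> T k x \<in> mspace (X (Suc k))"
begin

lemma orbit_map_in: "x \<in> mspace (X 0) \<Longrightarrow> orbit_map T j x \<in> mspace (X j)"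
  by (induction j) (auto intro: maps)

lemma bowen_dist_triangle_le:
  assumes "0 < n" "x \<in> mspace (X 0)" "y \<in> mspace (X 0)" "z \<in> mspace (X 0)"
    and "bowen_dist X T n x y \<le> a" "bowen_dist X T n y z \<le> b"
  shows "bowen_dist X T n x z \<le> a + b"
  unfolding bowen_dist_le_iff[OF assms(1)]
proof (intro allI impI)
  fix j assume "j < n"
  have "mdist (X j) (orbit_map T j x) (orbit_map T j z) \<le>
      mdist (X j) (orbit_map T j x) (orbit_map T j y) +
      mdist (X j) (orbit_map T j y) (orbit_map T j z)"
    using assms by (intro mdist_triangle orbit_map_in)
  also have "\<dots> \<le> a + b"
    using assms \<open>j < n\<close> by (intro add_mono) (auto simp: bowen_dist_le_iff)
  finally show "mdist (X j) (orbit_map T j x) (orbit_map T j z) \<le> a + b" .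
qed

lemma bowen_dist_self_le:
  "0 < n \<Longrightarrow> x \<in> mspace (X 0) \<Longrightarrow> 0 \<le> e \<Longrightarrow> bowen_dist X T n x x \<le> e"
  using mdist_zero[THEN iffD2, OF orbit_map_in orbit_map_in refl] by (simp add: bowen_dist_le_iff)

text \<open>A point of \<open>Z\<close> farther than \<open>e\<close> from every point of a maximal
  separated set could be added to that set.\<close>

lemma maximal_separated_spanning:
  assumes "0 < n" "0 \<le> e" "Z \<subseteq> mspace (X 0)"
  obtains E where "separated X T Z n e E" "spanning X T Z n e E"
proof -
  have "\<exists>M\<in>{E. separated X T Z n e E}. \<forall>E\<in>{E. separated X T Z n e E}. M \<subseteq> E \<longrightarrow> E = M"
  proof (rule subset_Zorn')
    fix C assume C: "subset.chain {E. separated X T Z n e E} C"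
    \<comment> \<open>A chain is totally ordered, so two points of its union already lie in one
      member, where their separation is known.\<close>
    have "\<exists>A\<in>C. x \<in> A \<and> y \<in> A" if "x \<in> \<Union>C" "y \<in> \<Union>C" for x y
      using C that unfolding subset.chain_def by blast
    moreover have "separated X T Z n e A" if "A \<in> C" for A
      using C that unfolding subset.chain_def by blast
    ultimately show "\<Union>C \<in> {E. separated X T Z n e E}"
      unfolding separated_def mem_Collect_eq by (metis Sup_least)
  qed
  then obtain E where E: "separated X T Z n e E"
    and max: "\<And>E'. separated X T Z n e E' \<Longrightarrow> E \<subseteq> E' \<Longrightarrow> E' = E"
    by blast
  have "\<exists>y\<in>E. bowen_dist X T n x y \<le> e" if x: "x \<in> Z" for x
  proof (rule ccontr)
    assume "\<not> (\<exists>y\<in>E. bowen_dist X T n x y \<le> e)"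
    then have far: "\<And>y. y \<in> E \<Longrightarrow> e < bowen_dist X T n x y"
      by (auto simp: not_le)
    moreover have "\<And>y. y \<in> E \<Longrightarrow> e < bowen_dist X T n y x"
      using far by (subst bowen_dist_commute)
    ultimately have "separated X T Z n e (insert x E)"
      using E x by (auto simp: separated_def)
    then have "x \<in> E"
      using max by blast
    then show False
      using far[of x] bowen_dist_self_le[of n x e] assms x by force
  qed
  then have "spanning X T Z n e E"
    using E assms(3) by (auto simp: spanning_def separated_def)
  with E show thesis
    by (rule that)
qed

lemma Q_n_le_P_n:
  assumes "0 < n" "0 \<le> e" "Z \<subseteq> mspace (X 0)"
  shows "Q_n X T f Z e n \<le> P_n X T f Z e n"
proof -
  obtain E where E: "separated X T Z n e E" "spanning X T Z n e E"
    using maximal_separated_spanning[OF assms] .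
  have "Q_n X T f Z e n \<le> exp_sum T f n E"
    unfolding Q_n_def using E by (intro INF_lower) auto
  also have "\<dots> \<le> P_n X T f Z e n"
    unfolding P_n_def using E by (intro SUP_upper) auto
  finally show ?thesis .
qed

text \<open>
  Sending each point of a \<open>2 e\<close>-separated set to an \<open>e\<close>-close point of a spanning set is injective
  and changes the Birkhoff sum by at most \<open>n * \<eta>\<close>.
\<close>

lemma P_n_le_Q_n:
  assumes n: "0 < n" and Z: "Z \<subseteq> mspace (X 0)"
    and mod: "\<And>k x y. x \<in> mspace (X k) \<Longrightarrow> y \<in> mspace (X k) \<Longrightarrow> mdist (X k) x y \<le> e \<Longrightarrow>
      f k x \<le> \<eta> + f k y"
  shows "ereal (exp (- (real n * \<eta>))) * P_n X T f Z (2 * e) n \<le> Q_n X T f Z e n"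
proof -
  have "ereal (exp (- (real n * \<eta>))) * exp_sum T f n E \<le> exp_sum T f n F"
    if E: "separated X T Z n (2 * e) E" and F: "spanning X T Z n e F" for E F
  proof -
    have "\<forall>x\<in>E. \<exists>y\<in>F. bowen_dist X T n x y \<le> e"
      using E F by (auto simp: separated_def spanning_def)
    then obtain \<phi> where \<phi>: "\<And>x. x \<in> E \<Longrightarrow> \<phi> x \<in> F" "\<And>x. x \<in> E \<Longrightarrow> bowen_dist X T n x (\<phi> x) \<le> e"
      by metis
    have E_in: "x \<in> mspace (X 0)" if "x \<in> E" for x
      using E Z that by (auto simp: separated_def)
    have \<phi>_in: "\<phi> x \<in> mspace (X 0)" if "x \<in> E" for x
      using F \<phi>(1)[OF that] by (auto simp: spanning_def)
    show ?thesis
    proof (rule exp_sum_inj_le[where \<phi> = \<phi>])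
      show "inj_on \<phi> E"
      proof (rule inj_onI)
        fix x y assume xy: "x \<in> E" "y \<in> E" "\<phi> x = \<phi> y"
        have "bowen_dist X T n x y \<le> e + e"
          using xy \<phi>(2)[of x] \<phi>(2)[of y] bowen_dist_commute[of X T n y "\<phi> y"]
          by (intro bowen_dist_triangle_le[of n x "\<phi> x" y] n E_in \<phi>_in) auto
        then show "x = y"
          using E xy by (force simp: separated_def)
      qed
      show "\<phi> ` E \<subseteq> F"
        using \<phi> by auto
      fix x assume x: "x \<in> E"
      have "birkhoff_sum T f n x \<le> (\<Sum>j<n. \<eta> + f j (orbit_map T j (\<phi> x)))"
        unfolding birkhoff_sum_def using \<phi>(2)[OF x] n
        by (intro sum_mono mod orbit_map_in E_in \<phi>_in x) (auto simp: bowen_dist_le_iff)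
      also have "\<dots> = real n * \<eta> + birkhoff_sum T f n (\<phi> x)"
        by (simp add: sum.distrib birkhoff_sum_def)
      finally show "birkhoff_sum T f n x \<le> real n * \<eta> + birkhoff_sum T f n (\<phi> x)" .
    qed
  qed
  \<comment> \<open>The family of separated sets is nonempty, so the constant factor can move inside
    the supremum.\<close>
  moreover have "separated X T Z n (2 * e) {}"
    by (simp add: separated_def)
  ultimately show ?thesis
    unfolding Q_n_def P_n_def
    by (subst Sup_ereal_mult_left') (auto intro!: SUP_least INF_greatest)
qed

end

section \<open>Pressures\<close>

text \<open>A smaller radius leaves fewer spanning sets to minimise over and, for
  \<open>P_n\<close>, more separated sets to maximise over.\<close>

lemma Q_n_antimono: "e \<le> e' \<Longrightarrow> Q_n X T f Z e' n \<le> Q_n X T f Z e n"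
  unfolding Q_n_def spanning_def by (intro INF_superset_mono) (auto, meson order_trans)

lemma P_n_antimono: "e \<le> e' \<Longrightarrow> P_n X T f Z e' n \<le> P_n X T f Z e n"
  unfolding P_n_def separated_def by (intro SUP_subset_mono) force+

lemma Q_n_nonneg: "0 \<le> Q_n X T f Z e n"
  unfolding Q_n_def by (intro INF_greatest exp_sum_nonneg)

lemma exp_sum_le_P_n: "separated X T Z n e E \<Longrightarrow> exp_sum T f n E \<le> P_n X T f Z e n"
  unfolding P_n_def by (intro SUP_upper) auto

lemma P_n_nonneg: "0 \<le> P_n X T f Z e n"
  using exp_sum_le_P_n[of X T Z n e "{}" f] exp_sum_nonneg[of T f n "{}"]
  by (auto simp: separated_def intro: order_trans)

lemma P_n_pos: "Z \<noteq> {} \<Longrightarrow> 0 < P_n X T f Z e n"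
proof -
  assume "Z \<noteq> {}"
  then obtain z where "z \<in> Z" by auto
  then have "exp_sum T f n {z} \<le> P_n X T f Z e n"
    by (intro exp_sum_le_P_n) (auto simp: separated_def)
  then show ?thesis
    using exp_sum_pos[of "{z}" T f n] by (auto intro: less_le_trans)
qed

lemma P_n_empty: "P_n X T f {} e n = 0"
proof -
  have "{E. separated X T {} n e E} = {{}}"
    by (auto simp: separated_def)
  then show ?thesis
    by (simp add: P_n_def exp_sum_def)
qed

lemma growth_rate_P_n_empty: "0 < n \<Longrightarrow> growth_rate (P_n X T f {} e) n = - \<infinity>"
  by (simp add: growth_rate_def P_n_empty log_ereal_def)

lemma Liminf_growth_mono: "(\<And>n. a n \<le> b n) \<Longrightarrow> liminf (growth_rate a) \<le> liminf (growth_rate b)"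
  by (intro Liminf_mono always_eventually allI growth_rate_mono)

lemma Limsup_growth_mono: "(\<And>n. a n \<le> b n) \<Longrightarrow> limsup (growth_rate a) \<le> limsup (growth_rate b)"
  by (intro Limsup_mono always_eventually allI growth_rate_mono)

lemma lower_Q_eq: "lower_Q X T f Z = (SUP e\<in>{0<..}. liminf (growth_rate (Q_n X T f Z e)))"
  unfolding lower_Q_def by (intro antimono_Lim_at_right Liminf_growth_mono Q_n_antimono)

lemma upper_Q_eq: "upper_Q X T f Z = (SUP e\<in>{0<..}. limsup (growth_rate (Q_n X T f Z e)))"
  unfolding upper_Q_def by (intro antimono_Lim_at_right Limsup_growth_mono Q_n_antimono)

text \<open>The lower bound for products adds two pressures as limits along one common radius, so
  convergence itself is recorded besides the supremum.\<close>

lemma tendsto_lower_P: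
  "((\<lambda>e. liminf (growth_rate (P_n X T f Z e))) \<longlongrightarrow> lower_P X T f Z) (at_right 0)"
  unfolding lower_P_def
  by (subst antimono_Lim_at_right)
    (intro antimono_tendsto_SUP_at_right Liminf_growth_mono P_n_antimono | assumption)+

lemma tendsto_upper_P:
  "((\<lambda>e. limsup (growth_rate (P_n X T f Z e))) \<longlongrightarrow> upper_P X T f Z) (at_right 0)"
  unfolding upper_P_def
  by (subst antimono_Lim_at_right)
    (intro antimono_tendsto_SUP_at_right Limsup_growth_mono P_n_antimono | assumption)+

lemma lower_P_eq: "lower_P X T f Z = (SUP e\<in>{0<..}. liminf (growth_rate (P_n X T f Z e)))"
  unfolding lower_P_def by (intro antimono_Lim_at_right Liminf_growth_mono P_n_antimono)

lemma upper_P_eq: "upper_P X T f Z = (SUP e\<in>{0<..}. limsup (growth_rate (P_n X T f Z e)))"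
  unfolding upper_P_def by (intro antimono_Lim_at_right Limsup_growth_mono P_n_antimono)

text \<open>Doubling the radius is harmless in a supremum over all radii, and the error \<eta> is
  arbitrary. Here \<open>p\<close> stands for separated rates and \<open>q\<close> for spanning
  rates, with either \<open>liminf\<close> or \<open>limsup\<close>.\<close>

lemma SUP_pos_eqI:
  fixes p q :: "real \<Rightarrow> ereal"
  assumes anti: "\<And>x y. 0 < x \<Longrightarrow> x \<le> y \<Longrightarrow> p y \<le> p x"
    and qp: "\<And>x. 0 < x \<Longrightarrow> q x \<le> p x"
    and pq: "\<And>\<eta>::real. 0 < \<eta> \<Longrightarrow> \<exists>d>0. \<forall>e. 0 < e \<longrightarrow> e < d \<longrightarrow> p (2 * e) \<le> ereal \<eta> + q e"
  shows "(SUP x\<in>{0<..}. q x) = (SUP x\<in>{0<..}. p x)"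
proof (rule antisym)
  show "(SUP x\<in>{0<..}. q x) \<le> (SUP x\<in>{0<..}. p x)"
    using qp by (intro SUP_mono) auto
  show "(SUP x\<in>{0<..}. p x) \<le> (SUP x\<in>{0<..}. q x)"
  proof (rule ereal_le_epsilon2)
    fix \<eta> :: real assume "0 < \<eta>"
    from pq[OF this] obtain d
      where d: "d > 0" "\<And>e. 0 < e \<Longrightarrow> e < d \<Longrightarrow> p (2 * e) \<le> ereal \<eta> + q e"
      by blast
    show "(SUP x\<in>{0<..}. p x) \<le> (SUP x\<in>{0<..}. q x) + ereal \<eta>"
    proof (rule SUP_least)
      fix x :: real assume x: "x \<in> {0<..}"
      \<comment> \<open>Half the minimum gives both \<open>2 * e \<le> x\<close>, for monotonicity
        of \<open>p\<close>, and \<open>e < d\<close>, for the comparison.\<close>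
      define e where "e = min x d / 2"
      have e: "0 < e" "2 * e \<le> x" "e < d"
        using x d(1) by (auto simp: e_def)
      have "p x \<le> p (2 * e)"
        using e by (intro anti) auto
      also have "\<dots> \<le> ereal \<eta> + q e"
        using d(2) e by blast
      also have "\<dots> \<le> ereal \<eta> + (SUP x\<in>{0<..}. q x)"
        using e by (intro add_left_mono SUP_upper) auto
      finally show "p x \<le> (SUP x\<in>{0<..}. q x) + ereal \<eta>"
        by (simp add: add.commute)
    qed
  qed
qed

section \<open>Agreement of spanning and separated pressures under equicontinuity\<close>

context invariant_maps
begin

text \<open>Equicontinuity gives one \<open>d\<close> for all times \<open>k\<close>. The resulting
  factor \<open>exp (- (n * \<eta>))\<close> contributes exactly -\<eta> to the growth rate,
  uniformly in \<open>n\<close>.\<close>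

lemma growth_rate_P_n_le:
  assumes eq: "equicontinuous X f" and Z: "Z \<subseteq> mspace (X 0)" and \<eta>: "0 < \<eta>"
  shows "\<exists>d>0. \<forall>e. 0 < e \<longrightarrow> e < d \<longrightarrow>
    (\<forall>n>0. growth_rate (P_n X T f Z (2 * e)) n \<le> ereal \<eta> + growth_rate (Q_n X T f Z e) n)"
proof -
  obtain d where d: "d > 0" "\<And>k x y. x \<in> mspace (X k) \<Longrightarrow> y \<in> mspace (X k) \<Longrightarrow>
      mdist (X k) x y < d \<Longrightarrow> \<bar>f k x - f k y\<bar> < \<eta>"
    using eq \<eta> unfolding equicontinuous_def by meson
  have "growth_rate (P_n X T f Z (2 * e)) n \<le> ereal \<eta> + growth_rate (Q_n X T f Z e) n"
    if e: "0 < e" "e < d" and n: "n > 0" for e n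
  proof -
    have "f k x \<le> \<eta> + f k y"
      if "x \<in> mspace (X k)" "y \<in> mspace (X k)" "mdist (X k) x y \<le> e" for k x y
      using d(2)[OF that(1,2)] that(3) e by linarith
    then have "ereal (exp (- (real n * \<eta>))) * P_n X T f Z (2 * e) n \<le> Q_n X T f Z e n"
      by (intro P_n_le_Q_n n Z) auto
    then have "growth_rate (\<lambda>n. ereal (exp (- (real n * \<eta>))) * P_n X T f Z (2 * e) n) n
        \<le> growth_rate (Q_n X T f Z e) n"
      by (intro growth_rate_mono)
    moreover have "growth_rate (\<lambda>n. ereal (exp (- (real n * \<eta>))) * P_n X T f Z (2 * e) n) n
        = ereal (- \<eta>) + growth_rate (P_n X T f Z (2 * e)) n"
      using n unfolding growth_rate_def
      by (subst log_ereal_exp_mult[OF P_n_nonneg], subst ereal_pos_distrib) auto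
    ultimately show ?thesis
      by (cases "growth_rate (P_n X T f Z (2 * e)) n"; cases "growth_rate (Q_n X T f Z e) n") auto
  qed
  then show ?thesis
    using d(1) by blast
qed

lemma lower_Q_eq_lower_P:
  assumes eq: "equicontinuous X f" and Z: "Z \<subseteq> mspace (X 0)"
  shows "lower_Q X T f Z = lower_P X T f Z"
  unfolding lower_Q_eq lower_P_eq
proof (rule SUP_pos_eqI)
  show "liminf (growth_rate (P_n X T f Z y)) \<le> liminf (growth_rate (P_n X T f Z x))"
    if "x \<le> y" for x y
    using that by (intro Liminf_growth_mono P_n_antimono)
  show "liminf (growth_rate (Q_n X T f Z x)) \<le> liminf (growth_rate (P_n X T f Z x))"
    if "0 < x" for x
    using that Z by (intro Liminf_mono eventually_sequentiallyI[of 1] growth_rate_mono Q_n_le_P_n) auto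
  fix \<eta> :: real assume "0 < \<eta>"
  from growth_rate_P_n_le[OF eq Z this] obtain d where d: "d > 0"
    "\<And>e n. 0 < e \<Longrightarrow> e < d \<Longrightarrow> 0 < n \<Longrightarrow>
       growth_rate (P_n X T f Z (2 * e)) n \<le> ereal \<eta> + growth_rate (Q_n X T f Z e) n"
    by blast
  \<comment> \<open>The constant \<eta> is finite and can be moved inside the
    \<open>liminf\<close>.\<close>
  have "liminf (growth_rate (P_n X T f Z (2 * e))) \<le> ereal \<eta> + liminf (growth_rate (Q_n X T f Z e))"
    if "0 < e" "e < d" for e
    using that by (subst Liminf_add_ereal_left[symmetric])
      (auto intro!: Liminf_mono eventually_sequentiallyI[of 1] d(2))
  then show "\<exists>d>0. \<forall>e. 0 < e \<longrightarrow> e < d \<longrightarrow> liminf (growth_rate (P_n X T f Z (2 * e)))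
      \<le> ereal \<eta> + liminf (growth_rate (Q_n X T f Z e))"
    using d(1) by blast
qed

lemma upper_Q_eq_upper_P:
  assumes eq: "equicontinuous X f" and Z: "Z \<subseteq> mspace (X 0)"
  shows "upper_Q X T f Z = upper_P X T f Z"
  unfolding upper_Q_eq upper_P_eq
proof (rule SUP_pos_eqI)
  show "limsup (growth_rate (P_n X T f Z y)) \<le> limsup (growth_rate (P_n X T f Z x))"
    if "x \<le> y" for x y
    using that by (intro Limsup_growth_mono P_n_antimono)
  show "limsup (growth_rate (Q_n X T f Z x)) \<le> limsup (growth_rate (P_n X T f Z x))"
    if "0 < x" for x
    using that Z by (intro Limsup_mono eventually_sequentiallyI[of 1] growth_rate_mono Q_n_le_P_n) auto
  fix \<eta> :: real assume "0 < \<eta>"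
  from growth_rate_P_n_le[OF eq Z this] obtain d where d: "d > 0"
    "\<And>e n. 0 < e \<Longrightarrow> e < d \<Longrightarrow> 0 < n \<Longrightarrow>
       growth_rate (P_n X T f Z (2 * e)) n \<le> ereal \<eta> + growth_rate (Q_n X T f Z e) n"
    by blast
  have "limsup (growth_rate (P_n X T f Z (2 * e))) \<le> ereal \<eta> + limsup (growth_rate (Q_n X T f Z e))"
    if "0 < e" "e < d" for e
    using that by (subst Limsup_add_ereal_left[symmetric])
      (auto intro!: Limsup_mono eventually_sequentiallyI[of 1] d(2))
  then show "\<exists>d>0. \<forall>e. 0 < e \<longrightarrow> e < d \<longrightarrow> limsup (growth_rate (P_n X T f Z (2 * e)))
      \<le> ereal \<eta> + limsup (growth_rate (Q_n X T f Z e))"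
    using d(1) by blast
qed

lemma pressure_L_eq:
  assumes "equicontinuous X f" "Z \<subseteq> mspace (X 0)"
  shows "pressure_L X T f Z = lower_P X T f Z"
  unfolding pressure_L_def lower_Q_eq_lower_P[OF assms] by simp

text \<open>Both descriptions are kept: the separated one serves the lower bound for products, the
  spanning one the upper bound.\<close>

lemma pressure_U_eq:
  assumes "equicontinuous X f" "Z \<subseteq> mspace (X 0)"
  shows "pressure_U X T f Z = upper_P X T f Z" "pressure_U X T f Z = upper_Q X T f Z"
  unfolding pressure_U_def upper_Q_eq_upper_P[OF assms] by simp_all

end

section \<open>Product systems\<close>

lemma orbit_map_prod_maps:
  "orbit_map (prod_maps T R) j = map_prod (orbit_map T j) (orbit_map R j)"
  by (induction j) (auto simp: prod_maps_def map_prod_def fun_eq_iff)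

lemma birkhoff_sum_prod:
  "birkhoff_sum (prod_maps T R) (dotplus f g) n (x, y) = birkhoff_sum T f n x + birkhoff_sum R g n y"
  by (simp add: birkhoff_sum_def orbit_map_prod_maps dotplus_def sum.distrib)

text \<open>With maximum metrics on the factors, the maximum over times splits into the two
  coordinates. Spanning uses this equivalence directly, separation uses its negation.\<close>

lemma bowen_dist_prod_le_iff:
  assumes "0 < n"
  shows "bowen_dist (prod_spaces X Y) (prod_maps T R) n p q \<le> e \<longleftrightarrow>
    bowen_dist X T n (fst p) (fst q) \<le> e \<and> bowen_dist Y R n (snd p) (snd q) \<le> e"
  unfolding bowen_dist_le_iff[OF assms]
  by (auto simp: prod_spaces_def mdist_max_metric orbit_map_prod_maps)

lemma spanning_prod:
  assumes "0 < n" "spanning X T Z n e F" "spanning Y R W n e G"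
  shows "spanning (prod_spaces X Y) (prod_maps T R) (Z \<times> W) n e (F \<times> G)"
  using assms(2,3) unfolding spanning_def
  by (fastforce simp: bowen_dist_prod_le_iff[OF assms(1)] prod_spaces_def)

lemma separated_prod:
  assumes "0 < n" "separated X T Z n e E" "separated Y R W n e D"
  shows "separated (prod_spaces X Y) (prod_maps T R) (Z \<times> W) n e (E \<times> D)"
  unfolding separated_def
proof (intro conjI ballI impI)
  show "E \<times> D \<subseteq> Z \<times> W"
    using assms(2,3) by (auto simp: separated_def)
  fix p q assume "p \<in> E \<times> D" "q \<in> E \<times> D" "p \<noteq> q"
  \<comment> \<open>Distinct pairs differ in some coordinate, and the separated set of that factor
    keeps them apart.\<close>
  then have "e < bowen_dist X T n (fst p) (fst q) \<or> e < bowen_dist Y R n (snd p) (snd q)"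
    using assms(2,3) by (cases "fst p = fst q") (auto simp: separated_def prod_eq_iff)
  then show "e < bowen_dist (prod_spaces X Y) (prod_maps T R) n p q"
    using bowen_dist_prod_le_iff[OF assms(1), of X Y T R p q e] by linarith
qed

lemma sum_exp_birkhoff_prod:
  "(\<Sum>p\<in>K \<times> L. exp (birkhoff_sum (prod_maps T R) (dotplus f g) n p)) =
    (\<Sum>x\<in>K. exp (birkhoff_sum T f n x)) * (\<Sum>y\<in>L. exp (birkhoff_sum R g n y))"
  by (simp add: sum.cartesian_product' birkhoff_sum_prod exp_add sum_product)

text \<open>Finite sums over rectangles factor because the Birkhoff sum of a pair is the sum of the
  two Birkhoff sums. Finite rectangles suffice to exhaust \<open>A \<times> B\<close>.\<close>

lemma exp_sum_prod:
  "exp_sum (prod_maps T R) (dotplus f g) n (A \<times> B) = exp_sum T f n A * exp_sum R g n B"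
proof (rule antisym)
  show "exp_sum (prod_maps T R) (dotplus f g) n (A \<times> B) \<le> exp_sum T f n A * exp_sum R g n B"
  proof (rule exp_sum_least)
    fix K assume K: "finite K" "K \<subseteq> A \<times> B"
    \<comment> \<open>Enlarge \<open>K\<close> to the rectangle of its projections, which is still
      finite and only adds positive terms.\<close>
    have "(\<Sum>p\<in>K. exp (birkhoff_sum (prod_maps T R) (dotplus f g) n p)) \<le>
        (\<Sum>p\<in>fst ` K \<times> snd ` K. exp (birkhoff_sum (prod_maps T R) (dotplus f g) n p))"
      using K by (intro sum_mono2) (auto simp: rev_image_eqI)
    then have "ereal (\<Sum>p\<in>K. exp (birkhoff_sum (prod_maps T R) (dotplus f g) n p)) \<le>
        ereal (\<Sum>x\<in>fst ` K. exp (birkhoff_sum T f n x)) *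
        ereal (\<Sum>y\<in>snd ` K. exp (birkhoff_sum R g n y))"
      by (simp add: sum_exp_birkhoff_prod)
    also have "\<dots> \<le> exp_sum T f n A * exp_sum R g n B"
      using K by (intro ereal_mult_mono sum_le_exp_sum) (auto intro!: sum_nonneg exp_sum_nonneg)
    finally show "ereal (\<Sum>p\<in>K. exp (birkhoff_sum (prod_maps T R) (dotplus f g) n p)) \<le>
        exp_sum T f n A * exp_sum R g n B" .
  qed
  \<comment> \<open>The supremum over subsets of \<open>B\<close> is taken first, with
    \<open>K\<close> fixed; the one over subsets of \<open>A\<close> follows.\<close>
  have *: "ereal (\<Sum>x\<in>K. exp (birkhoff_sum T f n x)) * exp_sum R g n B
      \<le> exp_sum (prod_maps T R) (dotplus f g) n (A \<times> B)" if K: "finite K" "K \<subseteq> A" for K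
  proof -
    have "ereal (\<Sum>x\<in>K. exp (birkhoff_sum T f n x)) * ereal (\<Sum>y\<in>L. exp (birkhoff_sum R g n y))
        \<le> exp_sum (prod_maps T R) (dotplus f g) n (A \<times> B)" if L: "finite L" "L \<subseteq> B" for L
      using sum_le_exp_sum[of "K \<times> L" "A \<times> B" "prod_maps T R" "dotplus f g" n] K L
      by (auto simp: sum_exp_birkhoff_prod)
    then show ?thesis
      unfolding exp_sum_eq_SUP[of R g n B]
      by (subst Sup_ereal_mult_left') (auto intro!: SUP_least sum_nonneg)
  qed
  have "exp_sum T f n A * exp_sum R g n B = exp_sum R g n B * exp_sum T f n A"
    by (rule mult.commute)
  also have "\<dots> \<le> exp_sum (prod_maps T R) (dotplus f g) n (A \<times> B)"
    unfolding exp_sum_eq_SUP[of T f n A]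
    by (subst SUP_ereal_mult_left[symmetric])
      (use * in \<open>auto simp: mult.commute[of "exp_sum R g n B"] exp_sum_nonneg intro!: SUP_least sum_nonneg\<close>)
  finally show "exp_sum T f n A * exp_sum R g n B
      \<le> exp_sum (prod_maps T R) (dotplus f g) n (A \<times> B)" .
qed

section \<open>Product estimates at a fixed time and radius\<close>

lemma P_n_prod_ge:
  assumes n: "0 < n"
  shows "P_n X T f Z e n * P_n Y R g W e n
    \<le> P_n (prod_spaces X Y) (prod_maps T R) (dotplus f g) (Z \<times> W) e n" (is "_ \<le> ?P")
proof -
  \<comment> \<open>The empty set is separated; nonemptiness lets each factor be pulled through a
    supremum, one factor at a time.\<close>
  have ne: "{E. separated X T Z n e E} \<noteq> {}" "{E. separated Y R W n e E} \<noteq> {}"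
    by (auto simp: separated_def)
  have "exp_sum T f n E * P_n Y R g W e n \<le> ?P" if E: "separated X T Z n e E" for E
  proof -
    have "exp_sum T f n E * exp_sum R g n D \<le> ?P" if "separated Y R W n e D" for D
      unfolding exp_sum_prod[symmetric] by (intro exp_sum_le_P_n separated_prod n E that)
    then show ?thesis
      unfolding P_n_def[of Y]
      by (subst SUP_ereal_mult_left[symmetric]) (use ne in \<open>auto intro!: SUP_least exp_sum_nonneg\<close>)
  qed
  then have "P_n Y R g W e n * P_n X T f Z e n \<le> ?P"
    unfolding P_n_def[of X]
    by (subst SUP_ereal_mult_left[symmetric])
      (use ne in \<open>auto simp: mult.commute[of "P_n Y R g W e n"] P_n_nonneg
        intro!: SUP_least exp_sum_nonneg\<close>)
  then show ?thesis
    by (simp add: mult.commute)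
qed

text \<open>
  Finiteness is needed: if one infimum were \<open>\<infinity>\<close> and the other an unattained \<open>0\<close>, the product of
  the infima would be \<open>0\<close> by the convention \<open>\<infinity> * 0 = 0\<close>.
\<close>

lemma Q_n_prod_le:
  assumes n: "0 < n" and fin: "Q_n X T f Z e n \<noteq> \<infinity>" "Q_n Y R g W e n \<noteq> \<infinity>"
  shows "Q_n (prod_spaces X Y) (prod_maps T R) (dotplus f g) (Z \<times> W) e n
    \<le> Q_n X T f Z e n * Q_n Y R g W e n" (is "?Q \<le> _")
proof -
  obtain r where r: "Q_n X T f Z e n = ereal r" "0 \<le> r"
    using fin(1) Q_n_nonneg[of X T f Z e n] by (cases "Q_n X T f Z e n") auto
  obtain s where s: "Q_n Y R g W e n = ereal s" "0 \<le> s"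
    using fin(2) Q_n_nonneg[of Y R g W e n] by (cases "Q_n Y R g W e n") auto
  \<comment> \<open>The infima may not be attained, so spanning sets within \<open>t\<close> of them
    are used and then \<open>t\<close> tends to 0.\<close>
  have le: "?Q \<le> ereal ((r + t) * (s + t))" if "0 < t" for t
  proof -
    have "Q_n X T f Z e n < ereal (r + t)" "Q_n Y R g W e n < ereal (s + t)"
      using r s that by auto
    then obtain F G where F: "spanning X T Z n e F" "exp_sum T f n F < ereal (r + t)"
      and G: "spanning Y R W n e G" "exp_sum R g n G < ereal (s + t)"
      unfolding Q_n_def by (auto simp: INF_less_iff)
    have "?Q \<le> exp_sum (prod_maps T R) (dotplus f g) n (F \<times> G)"
      unfolding Q_n_def using F G n by (intro INF_lower) (auto intro: spanning_prod)
    also have "\<dots> = exp_sum T f n F * exp_sum R g n G"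
      by (rule exp_sum_prod)
    also have "\<dots> \<le> ereal (r + t) * ereal (s + t)"
      using F G r(2) s(2) that by (intro ereal_mult_mono exp_sum_nonneg) auto
    finally show ?thesis
      by simp
  qed
  have "((\<lambda>t. ereal ((r + t) * (s + t))) \<longlongrightarrow> ereal ((r + 0) * (s + 0))) (at_right 0)"
    by (intro tendsto_intros)
  moreover have "eventually (\<lambda>t. ?Q \<le> ereal ((r + t) * (s + t))) (at_right 0)"
    using eventually_at_right_less[of "0::real"] by eventually_elim (rule le)
  ultimately have "?Q \<le> ereal ((r + 0) * (s + 0))"
    by (intro tendsto_lowerbound[of _ _ "at_right (0::real)"]) auto
  then show ?thesis
    using r s by simp
qed

text \<open>Nonemptiness makes both \<open>P_n\<close> positive, so the logarithm of the product
  splits exactly and the clash of \<open>0 * \<infinity>\<close> with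
  \<open>-\<infinity> + \<infinity>\<close> cannot occur.\<close>

lemma growth_rate_P_n_prod_ge:
  assumes n: "0 < n" and ne: "Z \<noteq> {}" "W \<noteq> {}"
  shows "growth_rate (P_n X T f Z e) n + growth_rate (P_n Y R g W e) n
    \<le> growth_rate (P_n (prod_spaces X Y) (prod_maps T R) (dotplus f g) (Z \<times> W) e) n"
proof -
  have "growth_rate (P_n X T f Z e) n + growth_rate (P_n Y R g W e) n
      = growth_rate (\<lambda>n. P_n X T f Z e n * P_n Y R g W e n) n"
    unfolding growth_rate_def
    by (subst log_ereal_mult) (auto simp: P_n_pos ne ereal_pos_distrib)
  also have "\<dots> \<le> growth_rate (P_n (prod_spaces X Y) (prod_maps T R) (dotplus f g) (Z \<times> W) e) n"
    by (intro growth_rate_mono P_n_prod_ge n)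
  finally show ?thesis .
qed

lemma growth_rate_Q_n_prod_le:
  assumes n: "0 < n"
  shows "growth_rate (Q_n (prod_spaces X Y) (prod_maps T R) (dotplus f g) (Z \<times> W) e) n
    \<le> growth_rate (Q_n X T f Z e) n + growth_rate (Q_n Y R g W e) n"
proof (cases "Q_n X T f Z e n = \<infinity> \<or> Q_n Y R g W e n = \<infinity>")
  \<comment> \<open>An infinite \<open>Q_n\<close> makes the right-hand side \<infinity>, even when
    the other rate is -\<infinity>.\<close>
  case True
  then show ?thesis
    using n by (auto simp: growth_rate_def log_ereal_def)
next
  case False
  then have "growth_rate (Q_n (prod_spaces X Y) (prod_maps T R) (dotplus f g) (Z \<times> W) e) n
      \<le> growth_rate (\<lambda>n. Q_n X T f Z e n * Q_n Y R g W e n) n"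
    by (intro growth_rate_mono Q_n_prod_le n) auto
  also have "\<dots> \<le> ereal (1 / real n) *
      (log_ereal (Q_n X T f Z e n) + log_ereal (Q_n Y R g W e n))"
    unfolding growth_rate_def
    by (intro ereal_mult_left_mono log_ereal_mult_le Q_n_nonneg) auto
  also have "\<dots> = growth_rate (Q_n X T f Z e) n + growth_rate (Q_n Y R g W e) n"
    unfolding growth_rate_def by (rule ereal_pos_distrib) auto
  finally show ?thesis .
qed

section \<open>Pressures of product systems\<close>

lemma upper_Q_prod_le:
  "upper_Q (prod_spaces X Y) (prod_maps T R) (dotplus f g) (Z \<times> W)
    \<le> upper_Q X T f Z + upper_Q Y R g W"
  unfolding upper_Q_eq[of "prod_spaces X Y"]
proof (rule SUP_least)
  fix e :: real assume e: "e \<in> {0<..}"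
  have "limsup (growth_rate (Q_n (prod_spaces X Y) (prod_maps T R) (dotplus f g) (Z \<times> W) e))
      \<le> limsup (\<lambda>n. growth_rate (Q_n X T f Z e) n + growth_rate (Q_n Y R g W e) n)"
    by (intro Limsup_mono eventually_sequentiallyI[of 1] growth_rate_Q_n_prod_le) auto
  also have "\<dots> \<le> limsup (growth_rate (Q_n X T f Z e)) + limsup (growth_rate (Q_n Y R g W e))"
    by (rule ereal_limsup_add_mono)
  also have "\<dots> \<le> upper_Q X T f Z + upper_Q Y R g W"
    unfolding upper_Q_eq using e by (intro add_mono SUP_upper)
  finally show "limsup (growth_rate (Q_n (prod_spaces X Y) (prod_maps T R) (dotplus f g) (Z \<times> W) e))
      \<le> upper_Q X T f Z + upper_Q Y R g W" .
qed

text \<open>Since log 0 is -\<infinity>, a pressure other than -\<infinity> forces its set to be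
  nonempty.\<close>

lemma lower_P_empty: "lower_P X T f {} = - \<infinity>"
proof -
  have "liminf (growth_rate (P_n X T f {} e)) = liminf (\<lambda>n. - \<infinity>)" for e
    by (intro Liminf_eq eventually_sequentiallyI[of 1]) (auto intro: growth_rate_P_n_empty)
  then show ?thesis
    by (simp add: lower_P_eq Liminf_const)
qed

lemma upper_P_empty: "upper_P X T f {} = - \<infinity>"
proof -
  have "limsup (growth_rate (P_n X T f {} e)) = limsup (\<lambda>n. - \<infinity>)" for e
    by (intro Limsup_eq eventually_sequentiallyI[of 1]) (auto intro: growth_rate_P_n_empty)
  then show ?thesis
    by (simp add: upper_P_eq Limsup_const)
qed

lemma upper_P_prod_ge:
  assumes wd: "sum_well_defined (lower_P X T f Z) (upper_P Y R g W)"
  shows "lower_P X T f Z + upper_P Y R g W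
    \<le> upper_P (prod_spaces X Y) (prod_maps T R) (dotplus f g) (Z \<times> W)"
proof (cases "lower_P X T f Z = - \<infinity> \<or> upper_P Y R g W = - \<infinity>")
  case True
  \<comment> \<open>Well-definedness keeps the other summand from being \<infinity>, where the
    totalised sum would be \<infinity>.\<close>
  then have "lower_P X T f Z + upper_P Y R g W = - \<infinity>"
    using wd by (auto simp: sum_well_defined_def)
  then show ?thesis
    by (simp only: ereal_less_eq)
next
  case False
  then have ne: "Z \<noteq> {}" "W \<noteq> {}"
    by (auto simp: lower_P_empty upper_P_empty)
  let ?l = "\<lambda>e. liminf (growth_rate (P_n X T f Z e))"
  let ?u = "\<lambda>e. limsup (growth_rate (P_n Y R g W e))"
  let ?p = "\<lambda>e. limsup (growth_rate
    (P_n (prod_spaces X Y) (prod_maps T R) (dotplus f g) (Z \<times> W) e))"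
  \<comment> \<open>Addition is continuous here because neither limit is -\<infinity>.\<close>
  have "((\<lambda>e. ?l e + ?u e) \<longlongrightarrow> lower_P X T f Z + upper_P Y R g W) (at_right 0)"
    using False by (intro tendsto_add_ereal_nonneg tendsto_lower_P tendsto_upper_P) auto
  moreover have "eventually (\<lambda>e. ?l e + ?u e \<le> ?p e) (at_right 0)"
  proof -
    \<comment> \<open>For small radii neither rate is -\<infinity> either, which rules out both
      excluded cases of \<open>ereal_liminf_add_limsup_le\<close>.\<close>
    have "eventually (\<lambda>e. - \<infinity> < ?l e) (at_right 0)" "eventually (\<lambda>e. - \<infinity> < ?u e) (at_right 0)"
      using False
      by (intro order_tendstoD(1)[OF tendsto_lower_P] order_tendstoD(1)[OF tendsto_upper_P]; simp)+
    then show ?thesis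
    proof eventually_elim
      case (elim e)
      then have "?l e + ?u e
          \<le> limsup (\<lambda>n. growth_rate (P_n X T f Z e) n + growth_rate (P_n Y R g W e) n)"
        by (intro ereal_liminf_add_limsup_le) auto
      also have "\<dots> \<le> ?p e"
        by (intro Limsup_mono eventually_sequentiallyI[of 1] growth_rate_P_n_prod_ge ne) auto
      finally show ?case .
    qed
  qed
  ultimately show ?thesis
    by (intro tendsto_le[OF _ tendsto_upper_P]) auto
qed

text \<open>Closeness in the maximum metric is closeness in both coordinates, each contributing half
  of the error. This makes the two versions of the pressure agree for the product system
  too.\<close>

lemma equicontinuous_dotplus:
  assumes f: "equicontinuous X f" and g: "equicontinuous Y g"
  shows "equicontinuous (prod_spaces X Y) (dotplus f g)"
  unfolding equicontinuous_def
proof (intro allI impI)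
  fix e :: real assume "0 < e"
  then have e: "0 < e / 2"
    by simp
  obtain c where c: "c > 0" "\<And>k x y. x \<in> mspace (X k) \<Longrightarrow> y \<in> mspace (X k) \<Longrightarrow>
      mdist (X k) x y < c \<Longrightarrow> \<bar>f k x - f k y\<bar> < e / 2"
    using f e unfolding equicontinuous_def by meson
  obtain d where d: "d > 0" "\<And>k x y. x \<in> mspace (Y k) \<Longrightarrow> y \<in> mspace (Y k) \<Longrightarrow>
      mdist (Y k) x y < d \<Longrightarrow> \<bar>g k x - g k y\<bar> < e / 2"
    using g e unfolding equicontinuous_def by meson
  have "\<bar>dotplus f g k p - dotplus f g k q\<bar> < e"
    if "p \<in> mspace (prod_spaces X Y k)" "q \<in> mspace (prod_spaces X Y k)"
      "mdist (prod_spaces X Y k) p q < min c d" for k p q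
  proof -
    have "\<bar>f k (fst p) - f k (fst q)\<bar> < e / 2" "\<bar>g k (snd p) - g k (snd q)\<bar> < e / 2"
      using c(2)[of "fst p" k "fst q"] d(2)[of "snd p" k "snd q"] that
      by (auto simp only: prod_spaces_def mspace_max_metric mdist_max_metric mem_Times_iff
          max_less_iff_conj min_less_iff_conj)
    then show ?thesis
      unfolding dotplus_def case_prod_unfold by linarith
  qed
  then show "\<exists>\<delta>>0. \<forall>k. \<forall>x\<in>mspace (prod_spaces X Y k). \<forall>y\<in>mspace (prod_spaces X Y k).
      mdist (prod_spaces X Y k) x y < \<delta> \<longrightarrow> \<bar>dotplus f g k x - dotplus f g k y\<bar> < e"
    using c(1) d(1) by (intro exI[of _ "min c d"]) auto
qed

section \<open>The inequalities for products of nonautonomous systems\<close>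

lemma invariant_maps_nds: "nds X T \<Longrightarrow> invariant_maps X T"
  by unfold_locales (force simp: nds_def continuous_map_def)

lemma invariant_maps_prod:
  "invariant_maps X T \<Longrightarrow> invariant_maps Y R \<Longrightarrow> invariant_maps (prod_spaces X Y) (prod_maps T R)"
  by (auto simp: invariant_maps_def prod_spaces_def prod_maps_def)

theorem theorem6p4:
  fixes X :: "nat \<Rightarrow> 'a metric" and T :: "nat \<Rightarrow> 'a \<Rightarrow> 'a"
    and Y :: "nat \<Rightarrow> 'b metric" and R :: "nat \<Rightarrow> 'b \<Rightarrow> 'b"
    and f :: "nat \<Rightarrow> 'a \<Rightarrow> real" and g :: "nat \<Rightarrow> 'b \<Rightarrow> real"
    and Z :: "'a set" and W :: "'b set"
  assumes "nds X T" and "nds Y R"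
    and "Z \<subseteq> mspace (X 0)" and "W \<subseteq> mspace (Y 0)"
    and "f \<in> continuous_seqs X" and "equicontinuous X f"
    and "g \<in> continuous_seqs Y" and "equicontinuous Y g"
    and "sum_well_defined (pressure_L X T f Z) (pressure_U Y R g W)"
    and "sum_well_defined (pressure_U X T f Z) (pressure_U Y R g W)"
  shows "pressure_L X T f Z + pressure_U Y R g W
           \<le> pressure_U (prod_spaces X Y) (prod_maps T R) (dotplus f g) (Z \<times> W) \<and>
         pressure_U (prod_spaces X Y) (prod_maps T R) (dotplus f g) (Z \<times> W)
           \<le> pressure_U X T f Z + pressure_U Y R g W"
proof -
  interpret X: invariant_maps X T
    by (rule invariant_maps_nds) fact
  interpret Y: invariant_maps Y R
    by (rule invariant_maps_nds) fact
  interpret XY: invariant_maps "prod_spaces X Y" "prod_maps T R"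
    by (rule invariant_maps_prod) unfold_locales
  have eq: "equicontinuous (prod_spaces X Y) (dotplus f g)"
    by (rule equicontinuous_dotplus) fact+
  have ZW: "Z \<times> W \<subseteq> mspace (prod_spaces X Y 0)"
    using assms(3,4) by (auto simp: prod_spaces_def)
  show ?thesis
  proof
    show "pressure_L X T f Z + pressure_U Y R g W
        \<le> pressure_U (prod_spaces X Y) (prod_maps T R) (dotplus f g) (Z \<times> W)"
      using assms(9) unfolding X.pressure_L_eq[OF assms(6,3)] Y.pressure_U_eq(1)[OF assms(8,4)]
        XY.pressure_U_eq(1)[OF eq ZW]
      by (rule upper_P_prod_ge)
    show "pressure_U (prod_spaces X Y) (prod_maps T R) (dotplus f g) (Z \<times> W)
        \<le> pressure_U X T f Z + pressure_U Y R g W"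
      unfolding X.pressure_U_eq(2)[OF assms(6,3)] Y.pressure_U_eq(2)[OF assms(8,4)]
        XY.pressure_U_eq(2)[OF eq ZW]
      by (rule upper_Q_prod_le)
  qed
qed

end
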